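(* Let $A(q)=\prod_{j} f_j^{n_j}=:\sum_{n=0}^{\infty}a_nq^n$ be any eta quotient (a finite product, $j\in\mathbb{N}$, $n_j\in\mathbb{Z}$) such that $n_1$ is odd, and $n_j$ is even for every odd $j>1$. Let \[ B(q)=A(q)\frac{f_1^2f_2}{f_4}=:\sum_{n=0}^{\infty}b_nq^n. \] Then for all integers $n\ge 0$, \[ a_{2n}-b_{2n}\equiv 0 \pmod 4,\qquad a_{2n+1}+b_{2n+1}\equiv 0\pmod 4. \]
   Context: For $|q|<1$ and positive integers $j$, $f_j:=\prod_{n=1}^{\infty}(1-q^{jn})$. An eta quotient is a finite product $\prod_j f_j^{n_j}$ with $j\in\mathbb{N}$, $n_j\in\mathbb{Z}$; its power series expansion in $q$ has integer coefficients. *)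

theory Defs
  imports "HOL-Analysis.Analysis" "HOL-Number_Theory.Cong"
begin

text \<open>\<open>prodinf\<close> indexes from 0, hence the shift from \<open>n\<close> to \<open>n + 1\<close>. For \<open>norm q < 1\<close> and \<open>j \<ge> 1\<close>
  the product converges and is nonzero, so negative powers below are genuine.\<close>

definition eta_f :: "nat \<Rightarrow> complex \<Rightarrow> complex" where
  "eta_f j q = (\<Prod>n. 1 - q ^ (j * (n + 1)))"

text \<open>Only indices \<open>j \<ge> 1\<close> are used; the value of \<open>e\<close> at 0 is irrelevant.\<close>

definition eta_support :: "(nat \<Rightarrow> int) \<Rightarrow> nat set" where
  "eta_support e = {j. j \<ge> 1 \<and> e j \<noteq> 0}"

definition eta_quotient :: "(nat \<Rightarrow> int) \<Rightarrow> complex \<Rightarrow> complex" where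
  "eta_quotient e q = (\<Prod>j\<in>eta_support e. eta_f j q powi e j)"

definition has_int_q_expansion :: "(complex \<Rightarrow> complex) \<Rightarrow> (nat \<Rightarrow> int) \<Rightarrow> bool" where
  "has_int_q_expansion F a \<longleftrightarrow>
     (\<forall>q. norm q < 1 \<longrightarrow> (\<lambda>n. of_int (a n) * q ^ n) sums F q)"

end

theory Submission
  imports Defs "HOL-Complex_Analysis.Cauchy_Integral_Formula"
begin

text \<open>
  In terms of series the claim is \<open>A(-q) \<equiv> B(q)\<close> modulo 4, where congruence is taken in the ring of
  functions on the unit disk whose power series have integer coefficients. For even \<open>j\<close> the
  factor \<open>f\<^sub>j\<close> is invariant under \<open>q \<mapsto> -q\<close>; for odd \<open>j\<close> that substitution multiplies it by
  \<open>u\<^sub>j = f\<^sub>2\<^sub>j\<^sup>3 / (f\<^sub>j\<^sup>2 f\<^sub>4\<^sub>j)\<close>. Since \<open>F(q)\<^sup>2 \<equiv> F(q\<^sup>2)\<close> modulo 2 for every integer series \<open>F\<close>,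
  we have \<open>f\<^sub>j\<^sup>4 \<equiv> f\<^sub>2\<^sub>j\<^sup>2\<close> modulo 4. Hence \<open>u\<^sub>j\<^sup>2 \<equiv> 1\<close>, so only the odd exponent of \<open>f\<^sub>1\<close> contributes,
  and it contributes \<open>u\<^sub>1 = f\<^sub>2\<^sup>3 / (f\<^sub>1\<^sup>2 f\<^sub>4) \<equiv> f\<^sub>1\<^sup>2 f\<^sub>2 / f\<^sub>4\<close>.
\<close>

section \<open>Power series on the unit disk with integer coefficients\<close>

text \<open>Otherwise let \<open>m\<close> be the least index of a nonzero coefficient. Dividing the
  series by q^m leaves a series with constant term \<open>c m\<close> that still sums to 0, and
  letting q tend to 0 gives \<open>c m = 0\<close>.\<close>

lemma powser_coeff_zero:
  fixes c :: "nat \<Rightarrow> complex"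
  assumes "\<And>q. norm q < 1 \<Longrightarrow> (\<lambda>n. c n * q ^ n) sums 0"
  shows "c n = 0"
proof (rule ccontr)
  define m where "m = (LEAST k. c k \<noteq> 0)"
  assume "c n \<noteq> 0"
  hence m: "c m \<noteq> 0"
    unfolding m_def by (rule LeastI[of "\<lambda>k. c k \<noteq> 0"])
  have m': "c k = 0" if "k < m" for k
    using that not_less_Least unfolding m_def by blast
  define d where "d = (\<lambda>k. c (k + m))"
  have sd: "(\<lambda>k. d k * q ^ k) sums 0" if q: "norm q < 1" "q \<noteq> 0" for q
  proof -
    have "(\<lambda>k. c (k + m) * q ^ (k + m)) sums 0"
      using assms[OF q(1)] m' sums_iff_shift'[of "\<lambda>n. c n * q ^ n" m 0] by simp
    hence "(\<lambda>k. (c (k + m) * q ^ (k + m)) / q ^ m) sums (0 / q ^ m)"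
      by (rule sums_divide)
    thus ?thesis using q(2) by (simp add: d_def power_add)
  qed
  \<comment> \<open>The limit at 0 needs the sum only at nonzero points, where the division by q^m
    in \<open>sd\<close> was legitimate.\<close>
  have "((\<lambda>q::complex. 0) \<longlongrightarrow> d 0) (at 0)"
    by (rule powser_limit_0_strong[where s = 1]) (use sd in auto)
  hence "d 0 = 0" by (simp add: tendsto_const_iff)
  with m show False by (simp add: d_def)
qed

lemma powser_coeff_unique:
  fixes c d :: "nat \<Rightarrow> complex"
  assumes "\<And>q. norm q < 1 \<Longrightarrow> (\<lambda>n. c n * q ^ n) sums F q"
    and "\<And>q. norm q < 1 \<Longrightarrow> (\<lambda>n. d n * q ^ n) sums F q"
  shows "c n = d n"
proof -
  have "(\<lambda>n. (c n - d n) * q ^ n) sums 0" if "norm q < 1" for q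
    using sums_diff[OF assms(1)[OF that] assms(2)[OF that]] by (simp add: left_diff_distrib)
  from powser_coeff_zero[OF this] show ?thesis by simp
qed

text \<open>Convergence at a real \<open>r\<close> strictly between \<open>norm q\<close> and 1
  forces absolute convergence at \<open>q\<close>. The Cauchy product needs this.\<close>

lemma powser_disk_summable_norm:
  fixes c :: "nat \<Rightarrow> complex"
  assumes "\<And>q. norm q < 1 \<Longrightarrow> (\<lambda>n. c n * q ^ n) sums F q" "norm q < 1"
  shows "summable (\<lambda>n. norm (c n * q ^ n))"
proof -
  obtain r where r: "norm q < r" "r < 1" using assms(2) dense by blast
  hence "norm (of_real r :: complex) < 1" using norm_ge_zero[of q] by (simp del: norm_ge_zero)
  from assms(1)[OF this] have "summable (\<lambda>n. c n * of_real r ^ n)" by (rule sums_summable)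
  moreover have "norm q < norm (of_real r :: complex)" using r by simp
  ultimately show ?thesis by (rule powser_insidea)
qed

lemma powser_mult_sums:
  fixes c d :: "nat \<Rightarrow> complex"
  assumes "\<And>q. norm q < 1 \<Longrightarrow> (\<lambda>n. c n * q ^ n) sums F q"
    and "\<And>q. norm q < 1 \<Longrightarrow> (\<lambda>n. d n * q ^ n) sums G q"
    and q: "norm q < 1"
  shows "(\<lambda>n. (\<Sum>i\<le>n. c i * d (n - i)) * q ^ n) sums (F q * G q)"
proof -
  have "(\<lambda>n. \<Sum>i\<le>n. (c i * q ^ i) * (d (n - i) * q ^ (n - i))) sums
      ((\<Sum>n. c n * q ^ n) * (\<Sum>n. d n * q ^ n))"
    by (intro Cauchy_product_sums powser_disk_summable_norm[OF assms(1) q]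
        powser_disk_summable_norm[OF assms(2) q])
  moreover have "(\<Sum>i\<le>n. (c i * q ^ i) * (d (n - i) * q ^ (n - i))) =
      (\<Sum>i\<le>n. c i * d (n - i)) * q ^ n" for n
    unfolding sum_distrib_right
    by (rule sum.cong) (auto simp: mult_ac simp flip: power_add)
  ultimately show ?thesis
    using sums_unique[OF assms(1)[OF q]] sums_unique[OF assms(2)[OF q]] by simp
qed

section \<open>The ring of functions with an integer expansion on the unit disk\<close>

definition int_q_series :: "(complex \<Rightarrow> complex) set" where
  "int_q_series = {F. \<exists>a. has_int_q_expansion F a}"

lemma int_q_seriesI: "has_int_q_expansion F a \<Longrightarrow> F \<in> int_q_series"
  by (auto simp: int_q_series_def)

lemma int_q_seriesE:
  assumes "F \<in> int_q_series"
  obtains a where "has_int_q_expansion F a"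
  using assms by (auto simp: int_q_series_def)

lemma int_q_series_cong:
  assumes "F \<in> int_q_series" "\<And>q. norm q < 1 \<Longrightarrow> F q = G q"
  shows "G \<in> int_q_series"
  using assms by (auto simp: int_q_series_def has_int_q_expansion_def)

lemma has_int_q_expansion_monom:
  "has_int_q_expansion (\<lambda>q. of_int c * q ^ k) (\<lambda>n. if n = k then c else 0)"
  using sums_single[of k "\<lambda>n. of_int c * (_::complex) ^ n"]
  by (auto simp: has_int_q_expansion_def if_distrib[of of_int] if_distrib[of "\<lambda>x. x * _"] cong: if_cong)

lemma int_q_series_power_id: "(\<lambda>q. q ^ k) \<in> int_q_series"
  using int_q_seriesI[OF has_int_q_expansion_monom[of 1 k]] by simp

lemma int_q_series_of_int: "(\<lambda>q. of_int c) \<in> int_q_series"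
  using int_q_seriesI[OF has_int_q_expansion_monom[of c 0]] by simp

lemma int_q_series_1: "(\<lambda>q. 1) \<in> int_q_series"
  using int_q_series_of_int[of 1] by simp

lemma has_int_q_expansion_add:
  "has_int_q_expansion F a \<Longrightarrow> has_int_q_expansion G b \<Longrightarrow>
    has_int_q_expansion (\<lambda>q. F q + G q) (\<lambda>n. a n + b n)"
  by (auto simp: has_int_q_expansion_def distrib_right intro: sums_add)

lemma has_int_q_expansion_mult:
  assumes "has_int_q_expansion F a" "has_int_q_expansion G b"
  shows "has_int_q_expansion (\<lambda>q. F q * G q) (\<lambda>n. \<Sum>i\<le>n. a i * b (n - i))"
  using assms powser_mult_sums[of "\<lambda>n. of_int (a n)" F "\<lambda>n. of_int (b n)" G]
  by (auto simp: has_int_q_expansion_def)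

lemma has_int_q_expansion_cmult:
  "has_int_q_expansion F a \<Longrightarrow> has_int_q_expansion (\<lambda>q. of_int c * F q) (\<lambda>n. c * a n)"
  by (auto simp: has_int_q_expansion_def mult.assoc intro: sums_mult)

lemma has_int_q_expansion_reflect:
  assumes "has_int_q_expansion F a"
  shows "has_int_q_expansion (\<lambda>q. F (- q)) (\<lambda>n. (-1) ^ n * a n)"
  unfolding has_int_q_expansion_def
proof (intro allI impI)
  fix q :: complex assume "norm q < 1"
  hence "(\<lambda>n. of_int (a n) * (- q) ^ n) sums F (- q)"
    using assms by (auto simp: has_int_q_expansion_def)
  thus "(\<lambda>n. of_int ((-1) ^ n * a n) * q ^ n) sums F (- q)"
    by (simp add: power_minus[of q] mult_ac)
qed

lemma has_int_q_expansion_compose_square: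
  assumes "has_int_q_expansion F a"
  shows "has_int_q_expansion (\<lambda>q. F (q ^ 2)) (\<lambda>n. if even n then a (n div 2) else 0)"
  unfolding has_int_q_expansion_def
proof (intro allI impI)
  fix q :: complex assume q: "norm q < 1"
  let ?f = "\<lambda>n. of_int (if even n then a (n div 2) else 0) * q ^ n"
  have "norm (q ^ 2) < 1"
    using q by (simp add: norm_power power_less_one_iff)
  hence "(\<lambda>n. of_int (a n) * (q ^ 2) ^ n) sums F (q ^ 2)"
    using assms by (auto simp: has_int_q_expansion_def)
  hence "(\<lambda>n. ?f (2 * n)) sums F (q ^ 2)"
    by (simp add: power_mult)
  moreover have "strict_mono (\<lambda>n::nat. 2 * n)"
    by (auto simp: strict_mono_def)
  ultimately show "?f sums F (q ^ 2)"
    by (subst (asm) sums_mono_reindex) (auto elim!: evenE)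
qed

lemma has_int_q_expansion_unique:
  assumes "has_int_q_expansion F a" "has_int_q_expansion F b"
  shows "a = b"
proof
  fix n
  have "of_int (a n) = (of_int (b n) :: complex)"
    by (rule powser_coeff_unique[of _ F]) (use assms in \<open>auto simp: has_int_q_expansion_def\<close>)
  thus "a n = b n" by simp
qed

lemma int_q_series_add:
  "F \<in> int_q_series \<Longrightarrow> G \<in> int_q_series \<Longrightarrow> (\<lambda>q. F q + G q) \<in> int_q_series"
  unfolding int_q_series_def using has_int_q_expansion_add by blast

lemma int_q_series_mult:
  "F \<in> int_q_series \<Longrightarrow> G \<in> int_q_series \<Longrightarrow> (\<lambda>q. F q * G q) \<in> int_q_series"
  unfolding int_q_series_def using has_int_q_expansion_mult by blast

lemma int_q_series_diff:
  assumes "F \<in> int_q_series" "G \<in> int_q_series"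
  shows "(\<lambda>q. F q - G q) \<in> int_q_series"
  using int_q_series_add[OF assms(1) int_q_series_mult[OF int_q_series_of_int[of "-1"] assms(2)]]
  by simp

lemma int_q_series_power: "F \<in> int_q_series \<Longrightarrow> (\<lambda>q. F q ^ k) \<in> int_q_series"
  by (induction k) (auto simp: int_q_series_1 intro: int_q_series_mult)

lemma int_q_series_prod:
  "(\<And>i. i \<in> I \<Longrightarrow> F i \<in> int_q_series) \<Longrightarrow> (\<lambda>q. \<Prod>i\<in>I. F i q) \<in> int_q_series"
  by (induction I rule: infinite_finite_induct) (auto simp: int_q_series_1 intro: int_q_series_mult)

section \<open>Holomorphy, limits and inverses of integer series\<close>

lemma holomorphic_on_int_q_series:
  assumes "F \<in> int_q_series"
  shows "F holomorphic_on ball 0 1"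
proof -
  from assms obtain a where "has_int_q_expansion F a" by (rule int_q_seriesE)
  thus ?thesis
    by (intro power_series_holomorphic[of 0 1 "\<lambda>n. of_int (a n)"])
       (auto simp: has_int_q_expansion_def)
qed

lemma holomorphic_power_series_0:
  assumes "F holomorphic_on ball 0 1" "norm q < 1"
  shows "(\<lambda>n. (deriv ^^ n) F 0 / fact n * q ^ n) sums F q"
  using holomorphic_power_series[OF assms(1), of q] assms(2) by simp

text \<open>This splits membership into an analytic half, convergence on the whole disk, and an
  arithmetic half, integrality of the Taylor coefficients. For limits and inverses the two halves
  are proved separately.\<close>

lemma int_q_series_iff_deriv:
  "F \<in> int_q_series \<longleftrightarrow> F holomorphic_on ball 0 1 \<and> (\<forall>n. (deriv ^^ n) F 0 / fact n \<in> \<int>)"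
proof (intro iffI conjI allI)
  fix n
  assume F: "F \<in> int_q_series"
  then obtain a where "has_int_q_expansion F a" by (rule int_q_seriesE)
  hence "(deriv ^^ n) F 0 / fact n = of_int (a n)"
    using holomorphic_power_series_0[OF holomorphic_on_int_q_series[OF F]]
    by (intro powser_coeff_unique[of _ F]) (auto simp: has_int_q_expansion_def)
  thus "(deriv ^^ n) F 0 / fact n \<in> \<int>" by simp
next
  assume F: "F holomorphic_on ball 0 1 \<and> (\<forall>n. (deriv ^^ n) F 0 / fact n \<in> \<int>)"
  then obtain a where a: "\<And>n. (deriv ^^ n) F 0 / fact n = of_int (a n)"
    unfolding Ints_def image_iff by metis
  have "has_int_q_expansion F a"
    using holomorphic_power_series_0[of F] F unfolding has_int_q_expansion_def a by blast
  thus "F \<in> int_q_series" by (rule int_q_seriesI)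
qed (rule holomorphic_on_int_q_series)

text \<open>Taylor coefficients at 0 converge under locally uniform limits, and \<open>\<int>\<close> is closed.\<close>

lemma int_q_series_uniform_limit:
  assumes int: "\<And>N. P N \<in> int_q_series"
    and lim: "\<And>r. r < 1 \<Longrightarrow> uniform_limit (cball 0 r) P F sequentially"
  shows "F \<in> int_q_series"
  unfolding int_q_series_iff_deriv
proof (intro conjI allI)
  show "F holomorphic_on ball 0 1"
  proof (rule holomorphic_uniform_sequence[of _ P])
    fix x :: complex assume "x \<in> ball 0 1"
    then obtain d where d: "d > 0" "norm x + d < 1"
      by (metis add.commute dense diff_gt_0_iff_gt less_diff_eq mem_ball_0)
    \<comment> \<open>Uniform convergence is assumed on disks centred at 0 only, so the disk around
      \<open>x\<close> is placed inside such a disk.\<close>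
    have "cball x d \<subseteq> cball 0 (norm x + d)"
      by (metis cball_trans dist_0_norm mem_cball order_refl subsetI add.commute dist_commute)
    moreover have "cball 0 (norm x + d) \<subseteq> ball (0::complex) 1"
      using d by auto
    ultimately show "\<exists>d>0. cball x d \<subseteq> ball 0 1 \<and> uniform_limit (cball x d) P F sequentially"
      using d uniform_limit_on_subset[OF lim[OF d(2)]] by blast
  qed (use int holomorphic_on_int_q_series in auto)
  fix n
  have "(\<lambda>N. (deriv ^^ n) (P N) 0) \<longlonglongrightarrow> (deriv ^^ n) F 0"
  \<comment> \<open>The radius 1/2 is arbitrary: any disk around 0 of radius less than 1 would
    do.\<close>
  proof (rule higher_deriv_complex_uniform_limit[where A = "ball 0 (1/2)"])
    show "uniform_limit (ball 0 (1/2)) P F sequentially"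
      by (rule uniform_limit_on_subset[OF lim[of "1/2"]]) auto
    show "\<forall>\<^sub>F N in sequentially. P N holomorphic_on ball 0 (1/2)"
      by (intro always_eventually allI holomorphic_on_subset[OF holomorphic_on_int_q_series[OF int]]) auto
  qed auto
  hence "(\<lambda>N. (deriv ^^ n) (P N) 0 / fact n) \<longlonglongrightarrow> (deriv ^^ n) F 0 / fact n"
    by (intro tendsto_divide) auto
  moreover have "(deriv ^^ n) (P N) 0 / fact n \<in> \<int>" for N
    using int[of N] by (simp add: int_q_series_iff_deriv)
  ultimately show "(deriv ^^ n) F 0 / fact n \<in> \<int>"
    using Lim_in_closed_set[OF closed_Ints] by (metis (lifting) always_eventually trivial_limit_sequentially)
qed

text \<open>Since \<open>F\<close> has no zero in the disk, the inverse is holomorphic there and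
  equals its Taylor series. The constant term of \<open>F\<close> is 1, so comparing coefficients in
  F * G = 1 expresses each \<open>g n\<close> through earlier ones without division, and integrality
  follows by induction.\<close>

lemma int_q_series_inverse:
  assumes "F \<in> int_q_series" "F 0 = 1" and nz: "\<And>q. norm q < 1 \<Longrightarrow> F q \<noteq> 0"
  shows "(\<lambda>q. inverse (F q)) \<in> int_q_series"
proof -
  from assms(1) obtain a where a: "has_int_q_expansion F a" by (rule int_q_seriesE)
  define G where "G = (\<lambda>q. inverse (F q))"
  have holo: "G holomorphic_on ball 0 1"
    unfolding G_def using nz
    by (intro holomorphic_intros holomorphic_on_int_q_series[OF assms(1)]) auto
  define g where "g = (\<lambda>n. (deriv ^^ n) G 0 / fact n)"
  have g: "(\<lambda>n. g n * q ^ n) sums G q" if "norm q < 1" for q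
    unfolding g_def by (rule holomorphic_power_series_0[OF holo that])
  have a': "(\<lambda>n. of_int (a n) * q ^ n) sums F q" if "norm q < 1" for q
    using a that by (auto simp: has_int_q_expansion_def)
  have "(\<lambda>n. of_int (a n) * 0 ^ n) sums (of_int (a 0) :: complex)"
    by (rule powser_sums_zero)
  hence a0: "a 0 = 1"
    using a'[of 0] assms(2) sums_unique2 by fastforce
  have conv: "(\<Sum>i\<le>n. of_int (a i) * g (n - i)) = (if n = 0 then 1 else 0)" for n
  proof (rule powser_coeff_unique[where F = "\<lambda>q. F q * G q" and n = n and
        c = "\<lambda>n. \<Sum>i\<le>n. of_int (a i) * g (n - i)" and d = "\<lambda>n. if n = 0 then 1 else 0"])
    fix q :: complex assume q: "norm q < 1"
    show "(\<lambda>n. (\<Sum>i\<le>n. of_int (a i) * g (n - i)) * q ^ n) sums (F q * G q)"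
      by (rule powser_mult_sums[OF a' g q])
    show "(\<lambda>n. (if n = 0 then 1 else 0) * q ^ n) sums (F q * G q)"
      using has_int_q_expansion_monom[of 1 0] nz[OF q] q
      by (simp add: G_def has_int_q_expansion_def if_distrib[of of_int] cong: if_cong)
  qed
  have "g n \<in> \<int>" for n
  proof (induction n rule: less_induct)
    case (less n)
    have "(\<Sum>i\<le>n. of_int (a i) * g (n - i)) = g n + (\<Sum>i=1..n. of_int (a i) * g (n - i))"
      by (simp add: atMost_atLeast0 sum.atLeast_Suc_atMost a0)
    hence "g n = (if n = 0 then 1 else 0) - (\<Sum>i=1..n. of_int (a i) * g (n - i))"
      using conv[of n] by (simp add: algebra_simps)
    moreover have "(\<Sum>i=1..n. of_int (a i) * g (n - i)) \<in> \<int>"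
      by (intro Ints_sum Ints_mult less) auto
    ultimately show ?case by auto
  qed
  with holo show ?thesis
    unfolding int_q_series_iff_deriv g_def G_def by blast
qed

section \<open>Congruences between power series\<close>

text \<open>Equality is required on the disk only, because the infinite products carry no
  information outside it.\<close>

definition qcong :: "int \<Rightarrow> (complex \<Rightarrow> complex) \<Rightarrow> (complex \<Rightarrow> complex) \<Rightarrow> bool" where
  "qcong m F G \<longleftrightarrow>
    (\<exists>H\<in>int_q_series. \<forall>q. norm q < 1 \<longrightarrow> F q = G q + of_int m * H q)"

lemma qcong_cong:
  assumes "qcong m F G" "\<And>q. norm q < 1 \<Longrightarrow> F q = F' q" "\<And>q. norm q < 1 \<Longrightarrow> G q = G' q"
  shows "qcong m F' G'"
  using assms by (auto simp: qcong_def)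

lemma qcong_refl: "qcong m F F"
  unfolding qcong_def using int_q_series_of_int[of 0] by (intro bexI[of _ "\<lambda>_. of_int 0"]) auto

lemma qcong_sym:
  assumes "qcong m F G" shows "qcong m G F"
proof -
  from assms obtain H where H: "H \<in> int_q_series" "\<forall>q. norm q < 1 \<longrightarrow> F q = G q + of_int m * H q"
    by (auto simp: qcong_def)
  show ?thesis unfolding qcong_def
    by (rule bexI[OF _ int_q_series_mult[OF int_q_series_of_int[of "-1"] H(1)]]) (use H(2) in auto)
qed

lemma qcong_trans:
  assumes "qcong m F G" "qcong m G K" shows "qcong m F K"
proof -
  from assms obtain H H' where H: "H \<in> int_q_series" "\<forall>q. norm q < 1 \<longrightarrow> F q = G q + of_int m * H q"
     "H' \<in> int_q_series" "\<forall>q. norm q < 1 \<longrightarrow> G q = K q + of_int m * H' q"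
    unfolding qcong_def by blast
  show ?thesis unfolding qcong_def
    by (rule bexI[OF _ int_q_series_add[OF H(1,3)]]) (use H(2,4) in \<open>auto simp: algebra_simps\<close>)
qed

lemma qcong_mult_left:
  assumes "qcong m F G" "K \<in> int_q_series"
  shows "qcong m (\<lambda>q. K q * F q) (\<lambda>q. K q * G q)"
proof -
  from assms obtain H where H: "H \<in> int_q_series" "\<forall>q. norm q < 1 \<longrightarrow> F q = G q + of_int m * H q"
    by (auto simp: qcong_def)
  show ?thesis unfolding qcong_def
    by (rule bexI[OF _ int_q_series_mult[OF assms(2) H(1)]]) (use H(2) in \<open>auto simp: algebra_simps\<close>)
qed

lemma qcong_mult:
  assumes "qcong m F G" "qcong m F' G'" "F' \<in> int_q_series" "G \<in> int_q_series"
  shows "qcong m (\<lambda>q. F q * F' q) (\<lambda>q. G q * G' q)"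
  using qcong_trans[OF qcong_mult_left[OF assms(1,3)]] qcong_mult_left[OF assms(2,4)]
  by (simp add: mult.commute)

lemma qcong_one_mult:
  assumes "qcong m F (\<lambda>_. 1)" "qcong m G K" "G \<in> int_q_series"
  shows "qcong m (\<lambda>q. F q * G q) K"
  using qcong_mult[OF assms int_q_series_1] by simp

lemma qcong_one_power:
  assumes "qcong m F (\<lambda>_. 1)" "F \<in> int_q_series"
  shows "qcong m (\<lambda>q. F q ^ k) (\<lambda>_. 1)"
proof (induction k)
  case (Suc k)
  show ?case using qcong_one_mult[OF assms(1) Suc int_q_series_power[OF assms(2)]] by simp
qed (simp add: qcong_refl)

lemma qcong_one_prod:
  assumes "\<And>i. i \<in> I \<Longrightarrow> qcong m (F i) (\<lambda>_. 1)" "\<And>i. i \<in> I \<Longrightarrow> F i \<in> int_q_series"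
  shows "qcong m (\<lambda>q. \<Prod>i\<in>I. F i q) (\<lambda>_. 1)"
  using assms
proof (induction I rule: infinite_finite_induct)
  case (insert i I)
  hence "qcong m (\<lambda>q. F i q * (\<Prod>i\<in>I. F i q)) (\<lambda>_. 1)"
    by (intro qcong_one_mult int_q_series_prod) auto
  thus ?case using insert by simp
qed (simp_all add: qcong_refl)

text \<open>Multiplying the congruence for F^2 by F^(-2) shows that F^(-2) is also congruent to 1.
  An even power, of either sign, is a power of one of these two squares.\<close>

lemma qcong_power_int_even:
  assumes F: "F \<in> int_q_series" "F 0 = 1" "\<And>q. norm q < 1 \<Longrightarrow> F q \<noteq> 0"
    and sq: "qcong m (\<lambda>q. F q ^ 2) (\<lambda>_. 1)" and "even k"
  shows "qcong m (\<lambda>q. F q powi k) (\<lambda>_. 1)"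
proof -
  let ?G = "\<lambda>q. inverse (F q)"
  have G: "?G \<in> int_q_series" by (rule int_q_series_inverse[OF F])
  have "qcong m (\<lambda>q. ?G q ^ 2 * F q ^ 2) (\<lambda>q. ?G q ^ 2 * 1)"
    by (intro qcong_mult_left sq int_q_series_power G)
  hence "qcong m (\<lambda>_. 1) (\<lambda>q. ?G q ^ 2)"
    by (rule qcong_cong) (use F(3) in \<open>auto simp: field_simps\<close>)
  hence sq': "qcong m (\<lambda>q. ?G q ^ 2) (\<lambda>_. 1)" by (rule qcong_sym)
  obtain l where l: "nat \<bar>k\<bar> = 2 * l" using \<open>even k\<close> by (metis abs_ge_zero dvd_abs_iff evenE even_nat_iff)
  show ?thesis
  proof (cases "k \<ge> 0")
    case True
    hence "F q powi k = (F q ^ 2) ^ l" for q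
      using l by (simp add: power_int_def flip: power_mult)
    with qcong_one_power[OF sq int_q_series_power[OF F(1)], of l] show ?thesis by simp
  next
    case False
    hence "F q powi k = (?G q ^ 2) ^ l" for q
      using l by (simp add: power_int_def flip: power_mult)
    with qcong_one_power[OF sq' int_q_series_power[OF G], of l] show ?thesis by simp
  qed
qed

section \<open>Passing between congruences of functions and of coefficients; squaring\<close>

lemma qcong_imp_cong:
  assumes "qcong m F G" "has_int_q_expansion F a" "has_int_q_expansion G b"
  shows "[a n = b n] (mod m)"
proof -
  from assms(1) obtain H h where H: "has_int_q_expansion H h"
      "\<And>q. norm q < 1 \<Longrightarrow> F q = G q + of_int m * H q"
    by (auto simp: qcong_def int_q_series_def)
  have "has_int_q_expansion (\<lambda>q. G q + of_int m * H q) (\<lambda>n. b n + m * h n)"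
    by (intro has_int_q_expansion_add has_int_q_expansion_cmult assms H)
  hence "has_int_q_expansion F (\<lambda>n. b n + m * h n)"
    using H(2) by (auto simp: has_int_q_expansion_def)
  with assms(2) have "a n = b n + m * h n"
    by (metis has_int_q_expansion_unique)
  thus ?thesis by (simp add: cong_iff_dvd_diff)
qed

text \<open>The witness is (F - G) / m, whose coefficients are the integer quotients
  \<open>h n\<close>.\<close>

lemma qcongI:
  assumes a: "has_int_q_expansion F a" and b: "has_int_q_expansion G b"
    and ab: "\<And>n. [a n = b n] (mod m)" and "m \<noteq> 0"
  shows "qcong m F G"
proof -
  from ab have "\<forall>n. \<exists>h. a n - b n = m * h" by (auto simp: cong_iff_dvd_diff dvd_def)
  then obtain h where h: "\<And>n. a n - b n = m * h n" by metis
  define H where "H = (\<lambda>q. (F q - G q) / of_int m)"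
  have "has_int_q_expansion H h"
    unfolding has_int_q_expansion_def
  proof (intro allI impI)
    fix q :: complex assume "norm q < 1"
    hence "(\<lambda>n. (of_int (a n) * q ^ n - of_int (b n) * q ^ n) / of_int m) sums H q"
      unfolding H_def using a b
      by (intro sums_divide sums_diff) (auto simp: has_int_q_expansion_def)
    moreover have "(of_int (a n) * q ^ n - of_int (b n) * q ^ n) / of_int m = of_int (h n) * q ^ n" for n
    proof -
      have "of_int (a n) * q ^ n - of_int (b n) * q ^ n = of_int (m * h n) * q ^ n"
        unfolding h[symmetric] by (simp add: left_diff_distrib)
      thus ?thesis using \<open>m \<noteq> 0\<close> by simp
    qed
    ultimately show "(\<lambda>n. of_int (h n) * q ^ n) sums H q" by simp
  qed
  thus ?thesis
    unfolding qcong_def using \<open>m \<noteq> 0\<close>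
    by (intro bexI[of _ H]) (auto simp: H_def int_q_seriesI)
qed

text \<open>The terms \<open>i\<close> and \<open>n - i\<close> agree, so modulo 2 only the middle term survives.\<close>

lemma self_convolution_mod_2:
  fixes a :: "nat \<Rightarrow> int"
  shows "[(\<Sum>i\<le>n. a i * a (n - i)) = (if even n then a (n div 2) else 0)] (mod 2)"
proof -
  let ?f = "\<lambda>i. a i * a (n - i)"
  let ?L = "{i. 2 * i < n}" and ?R = "{i. i \<le> n \<and> n < 2 * i}" and ?M = "{i. 2 * i = n}"
  have fin: "finite ?L" "finite ?R" "finite ?M"
    by (auto intro: finite_subset[of _ "{..n}"])
  have "sum ?f {..n} = sum ?f (?L \<union> ?R \<union> ?M)"
    by (rule arg_cong[where f = "sum ?f"]) auto
  also have "\<dots> = sum ?f ?L + sum ?f ?R + sum ?f ?M"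
    using fin by (subst sum.union_disjoint; auto)+
  also have "sum ?f ?R = sum ?f ?L"
    by (rule sum.reindex_bij_witness[of _ "\<lambda>i. n - i" "\<lambda>i. n - i"]) auto
  also have "sum ?f ?M = (if even n then a (n div 2) * a (n div 2) else 0)"
  proof (cases "even n")
    case True
    then obtain k where k: "n = 2 * k" by (rule evenE)
    hence "?M = {k}" by auto
    thus ?thesis using k by simp
  next
    case False
    hence "?M = {}" by auto
    thus ?thesis using False by simp
  qed
  \<comment> \<open>The two equal halves add up to an even number, and the middle term uses that x^2
    and x have the same parity.\<close>
  finally show ?thesis by (auto simp: cong_iff_dvd_diff)
qed

lemma qcong_square_frobenius:
  assumes "F \<in> int_q_series"
  shows "qcong 2 (\<lambda>q. F q ^ 2) (\<lambda>q. F (q ^ 2))"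
proof -
  from assms obtain a where a: "has_int_q_expansion F a" by (rule int_q_seriesE)
  show ?thesis unfolding power2_eq_square[of "F _"]
    by (rule qcongI[OF has_int_q_expansion_mult[OF a a] has_int_q_expansion_compose_square[OF a]])
       (simp_all add: self_convolution_mod_2)
qed

text \<open>Squaring F = G + 2H gives F^2 = G^2 + 4(H + G)H, so the modulus doubles; (H + G)H is the
  witness.\<close>

lemma qcong_square_lift:
  assumes "qcong 2 F G" "G \<in> int_q_series"
  shows "qcong 4 (\<lambda>q. F q ^ 2) (\<lambda>q. G q ^ 2)"
proof -
  from assms obtain H where H: "H \<in> int_q_series" "\<forall>q. norm q < 1 \<longrightarrow> F q = G q + of_int 2 * H q"
    by (auto simp: qcong_def)
  show ?thesis unfolding qcong_def
    by (rule bexI[OF _ int_q_series_mult[OF int_q_series_add[OF H(1) assms(2)] H(1)]])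
       (use H(2) in \<open>auto simp: algebra_simps power2_eq_square\<close>)
qed

section \<open>The Euler products\<close>

lemma power_mult_Suc_eq:
  fixes x :: "'a :: monoid_mult"
  shows "x ^ (j * (n + 1)) = x ^ j * (x ^ j) ^ n"
  unfolding power_mult by simp

lemma abs_convergent_prod_eta:
  fixes q :: complex
  assumes "norm q < 1" "j \<ge> 1"
  shows "abs_convergent_prod (\<lambda>n. 1 - q ^ (j * (n + 1)))"
proof -
  have "norm (norm q ^ j) < 1" using assms by (simp add: power_less_one_iff)
  hence "summable (\<lambda>n. norm q ^ j * (norm q ^ j) ^ n)"
    by (intro summable_mult summable_geometric)
  moreover have "norm (1 - q ^ (j * (n + 1)) - 1) = norm q ^ j * (norm q ^ j) ^ n" for n
    unfolding power_mult_Suc_eq by (simp add: norm_mult norm_power)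
  ultimately have "summable (\<lambda>n. norm (1 - q ^ (j * (n + 1)) - 1))" by simp
  thus ?thesis by (rule summable_imp_abs_convergent_prod)
qed

lemma eta_f_LIMSEQ:
  assumes "norm q < 1" "j \<ge> 1"
  shows "(\<lambda>N. \<Prod>n<N. 1 - q ^ (j * (n + 1))) \<longlonglongrightarrow> eta_f j q"
  unfolding eta_f_def
  by (intro has_prod_imp_tendsto' convergent_prod_has_prod abs_convergent_prod_imp_convergent_prod
      abs_convergent_prod_eta assms)

lemma eta_f_nonzero:
  assumes "norm q < 1" "j \<ge> 1"
  shows "eta_f j q \<noteq> 0"
  unfolding eta_f_def
proof (rule prodinf_nonzero)
  fix n
  have "norm (q ^ (j * (n + 1))) < 1"
    unfolding norm_power using assms by (simp add: power_less_one_iff)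
  thus "1 - q ^ (j * (n + 1)) \<noteq> 0" by auto
qed (intro abs_convergent_prod_imp_convergent_prod abs_convergent_prod_eta assms)

lemma eta_f_0: "j \<ge> 1 \<Longrightarrow> eta_f j 0 = 1"
  by (simp add: eta_f_def power_0_left Suc_le_eq)

text \<open>The partial products are integer polynomials in q. On the closed disk of radius r < 1
  the Weierstrass test with the geometric majorant r^(j(n+1)) gives their uniform
  convergence.\<close>

lemma int_q_series_eta_f:
  assumes j: "j \<ge> 1"
  shows "eta_f j \<in> int_q_series"
proof (rule int_q_series_uniform_limit)
  let ?P = "\<lambda>N q. \<Prod>n<N. 1 - q ^ (j * (n + 1)) :: complex"
  show "?P N \<in> int_q_series" for N
    by (intro int_q_series_prod int_q_series_diff int_q_series_1 int_q_series_power_id)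
  fix r :: real assume r: "r < 1"
  show "uniform_limit (cball 0 r) ?P (eta_f j) sequentially"
  proof (cases "r \<ge> 0")
    case True
    have "uniformly_convergent_on (cball 0 r) ?P"
    proof (rule uniformly_convergent_on_prod')
      show "uniformly_convergent_on (cball 0 r) (\<lambda>N q. \<Sum>n<N. norm (1 - q ^ (j * (n + 1)) - 1 :: complex))"
      proof (rule Weierstrass_m_test')
        fix n and q :: complex assume "q \<in> cball 0 r"
        thus "norm (norm (1 - q ^ (j * (n + 1)) - 1)) \<le> r ^ (j * (n + 1))"
          unfolding diff_diff_eq2 by (simp add: norm_power power_mono del: mult_Suc_right)
      next
        have "norm (r ^ j) < 1" using r True j by (simp add: power_less_one_iff)
        hence "summable (\<lambda>n. r ^ j * (r ^ j) ^ n)"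
          by (intro summable_mult summable_geometric)
        thus "summable (\<lambda>n. r ^ (j * (n + 1)))"
          by (simp only: power_mult_Suc_eq)
      qed
    qed (auto intro!: continuous_intros)
    then obtain G where G: "uniform_limit (cball 0 r) ?P G sequentially"
      by (auto simp: uniformly_convergent_on_def)
    \<comment> \<open>The uniform limit \<open>G\<close> is so far abstract; pointwise it is a limit
      of the same partial products as \<open>eta_f j\<close>.\<close>
    have "G q = eta_f j q" if "q \<in> cball 0 r" for q
      using tendsto_uniform_limitI[OF G that] eta_f_LIMSEQ[OF _ j] that r
      by (intro LIMSEQ_unique) auto
    with G show ?thesis
      using uniform_limit_cong'[of "cball 0 r" ?P ?P G "eta_f j" sequentially] by blast
  \<comment> \<open>For negative \<open>r\<close> the disk is empty.\<close>
  qed (simp add: uniform_limit_iff)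
qed

lemma int_q_series_inverse_eta_f:
  "j \<ge> 1 \<Longrightarrow> (\<lambda>q. inverse (eta_f j q)) \<in> int_q_series"
  by (intro int_q_series_inverse int_q_series_eta_f eta_f_0 eta_f_nonzero)

lemma eta_f_compose_power: "eta_f j (q ^ k) = eta_f (k * j) q"
  by (simp add: eta_f_def algebra_simps flip: power_mult)

lemma eta_f_reflect_even: "even j \<Longrightarrow> eta_f j (- q) = eta_f j q"
  by (simp add: eta_f_def)

text \<open>Finite form of f_1(q) f_1(-q) f_4(q) = f_2(q)^3. The lengths \<open>N\<close> and
  \<open>2*N\<close> are balanced so that the identity is exact at every \<open>N\<close>; no
  infinite product has to be rearranged.\<close>

lemma prod_reflect_identity:
  fixes q :: "'a :: comm_ring_1"
  shows "(\<Prod>n<2*N. 1 - q ^ (n + 1)) * (\<Prod>n<2*N. 1 - (- q) ^ (n + 1)) * (\<Prod>n<N. 1 - q ^ (4 * (n + 1))) =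
    (\<Prod>n<N. 1 - q ^ (2 * (n + 1))) ^ 2 * (\<Prod>n<2*N. 1 - q ^ (2 * (n + 1)))"
proof (induction N)
  case (Suc N)
  \<comment> \<open>Passing from \<open>N\<close> to \<open>Suc N\<close> adds one odd power
    \<open>x\<close>, which changes sign under reflection, and one even power \<open>y\<close>,
    which does not.\<close>
  define x where "x = q ^ (2 * N + 1)"
  define y where "y = q ^ (2 * N + 2)"
  have eqs: "(- q) ^ (2 * N + 1) = - x" "(- q) ^ (2 * N + 2) = y"
    "q ^ (4 * (N + 1)) = y ^ 2" "q ^ (2 * (N + 1)) = y"
    "q ^ (2 * (2 * N + 1)) = x ^ 2" "q ^ (2 * (2 * N + 2)) = y ^ 2"
    unfolding x_def y_def power_mult[symmetric]
    by (simp, simp, (rule arg_cong[where f = "\<lambda>n. q ^ n"], simp)+)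
  have step: "(1 - x) * (1 - y) * ((1 + x) * (1 - y)) * (1 - y ^ 2) =
      (1 - y) ^ 2 * ((1 - x ^ 2) * (1 - y ^ 2))"
  proof -
    have "1 - x ^ 2 = (1 - x) * (1 + x)"
      by (simp add: algebra_simps power2_eq_square)
    thus ?thesis by (simp only: power2_eq_square[of "1 - y"] mult_ac)
  qed
  let ?A = "\<Prod>n<2*N. 1 - q ^ (n + 1)" and ?B = "\<Prod>n<2*N. 1 - (- q) ^ (n + 1)"
  let ?C = "\<Prod>n<N. 1 - q ^ (4 * (n + 1))" and ?D = "\<Prod>n<N. 1 - q ^ (2 * (n + 1))"
  let ?E = "\<Prod>n<2*N. 1 - q ^ (2 * (n + 1))"
  have p: "(\<Prod>n<2 * Suc N. f n) = (\<Prod>n<2*N. f n) * f (2 * N) * f (2 * N + 1)" for f :: "nat \<Rightarrow> 'a"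
    by simp
  have "(\<Prod>n<2*Suc N. 1 - q ^ (n + 1)) * (\<Prod>n<2*Suc N. 1 - (- q) ^ (n + 1)) *
      (\<Prod>n<Suc N. 1 - q ^ (4 * (n + 1))) =
      (?A * (1 - x) * (1 - y)) * (?B * (1 + x) * (1 - y)) * (?C * (1 - y ^ 2))"
    unfolding p prod.lessThan_Suc using eqs by (simp add: x_def y_def add.assoc)
  also have "\<dots> = (?A * ?B * ?C) * ((1 - x) * (1 - y) * ((1 + x) * (1 - y)) * (1 - y ^ 2))"
    by (simp only: mult_ac)
  also have "\<dots> = (?D * (1 - y)) ^ 2 * (?E * (1 - x ^ 2) * (1 - y ^ 2))"
    unfolding step Suc.IH power_mult_distrib by (simp only: mult_ac)
  also have "\<dots> = (\<Prod>n<Suc N. 1 - q ^ (2 * (n + 1))) ^ 2 * (\<Prod>n<2*Suc N. 1 - q ^ (2 * (n + 1)))"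
    unfolding p prod.lessThan_Suc using eqs by (simp add: add.assoc)
  finally show ?case .
qed simp

text \<open>Limit of the finite identity; products of length \<open>2*N\<close> converge as
  subsequences.\<close>

lemma eta_f_reflect_1:
  assumes "norm q < 1"
  shows "eta_f 1 q * eta_f 1 (- q) * eta_f 4 q = eta_f 2 q ^ 3"
proof -
  have double: "strict_mono (\<lambda>N::nat. 2 * N)" by (auto simp: strict_mono_def)
  note lim = eta_f_LIMSEQ[OF assms] and lim' = eta_f_LIMSEQ[of "- q"]
  note lim2 = LIMSEQ_subseq_LIMSEQ[OF _ double, unfolded o_def]
  have 1: "(\<lambda>N. (\<Prod>n<2*N. 1 - q ^ (n + 1)) * (\<Prod>n<2*N. 1 - (- q) ^ (n + 1)) * (\<Prod>n<N. 1 - q ^ (4 * (n + 1))))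
      \<longlonglongrightarrow> eta_f 1 q * eta_f 1 (- q) * eta_f 4 q"
    using lim2[OF lim[of 1]] lim2[OF lim'[of 1]] lim[of 4] assms by (intro tendsto_mult) simp_all
  have 2: "(\<lambda>N. (\<Prod>n<N. 1 - q ^ (2 * (n + 1))) ^ 2 * (\<Prod>n<2*N. 1 - q ^ (2 * (n + 1))))
      \<longlonglongrightarrow> eta_f 2 q ^ 2 * eta_f 2 q"
    using lim2[OF lim[of 2]] lim[of 2] by (intro tendsto_mult tendsto_power) simp_all
  show ?thesis
    using LIMSEQ_unique[OF 1[unfolded prod_reflect_identity] 2]
    by (simp add: power2_eq_square power3_eq_cube mult_ac)
qed

text \<open>This is the case j = 1 at the point q^j, since (-q)^j = -(q^j) for odd
  \<open>j\<close>.\<close>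

lemma eta_f_reflect_odd:
  assumes "norm q < 1" "odd j"
  shows "eta_f j q * eta_f j (- q) * eta_f (4 * j) q = eta_f (2 * j) q ^ 3"
proof -
  have "norm (q ^ j) < 1"
    unfolding norm_power using assms by (auto simp: power_less_one_iff odd_pos)
  from eta_f_reflect_1[OF this] show ?thesis
    using assms(2) eta_f_compose_power[of 1 "- q" j] by (simp add: eta_f_compose_power mult.commute)
qed

section \<open>Replacing \<open>q\<close> by \<open>-q\<close> in an eta quotient modulo 4\<close>

lemma qcong_eta_f_fourth:
  assumes "j \<ge> 1"
  shows "qcong 4 (\<lambda>q. eta_f j q ^ 4) (\<lambda>q. eta_f (2 * j) q ^ 2)"
proof -
  have "qcong 2 (\<lambda>q. eta_f j q ^ 2) (eta_f (2 * j))"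
    using qcong_square_frobenius[OF int_q_series_eta_f[OF assms]] by (simp add: eta_f_compose_power)
  from qcong_square_lift[OF this] show ?thesis
    using assms by (simp add: int_q_series_eta_f flip: power_mult)
qed

text \<open>The factor that f_j acquires under reflection. As a quotient it makes sense for every j
  >= 1 and is 1 for even \<open>j\<close>, so one product formula covers all indices.\<close>

definition eta_u :: "nat \<Rightarrow> complex \<Rightarrow> complex" where
  "eta_u j q = eta_f j (- q) / eta_f j q"

text \<open>Written with \<open>inverse\<close> so that the closure properties of integer series
  apply to each factor.\<close>

lemma eta_u_odd:
  assumes "norm q < 1" "odd j"
  shows "eta_u j q = eta_f (2 * j) q ^ 3 * inverse (eta_f j q) ^ 2 * inverse (eta_f (4 * j) q)"
proof -
  have "j \<ge> 1" using assms(2) by (simp add: Suc_le_eq odd_pos)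
  hence "eta_f j q \<noteq> 0" "eta_f (4 * j) q \<noteq> 0"
    by (simp_all add: eta_f_nonzero assms(1))
  with eta_f_reflect_odd[OF assms] show ?thesis
    unfolding eta_u_def by (simp add: field_simps power2_eq_square)
qed

lemma eta_u_0: "j \<ge> 1 \<Longrightarrow> eta_u j 0 = 1"
  by (simp add: eta_u_def eta_f_0)

lemma eta_u_nonzero: "norm q < 1 \<Longrightarrow> j \<ge> 1 \<Longrightarrow> eta_u j q \<noteq> 0"
  by (simp add: eta_u_def eta_f_nonzero)

lemma eta_u_even: "norm q < 1 \<Longrightarrow> j \<ge> 1 \<Longrightarrow> even j \<Longrightarrow> eta_u j q = 1"
  by (simp add: eta_u_def eta_f_nonzero eta_f_reflect_even)

lemma int_q_series_eta_u:
  assumes "j \<ge> 1"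
  shows "eta_u j \<in> int_q_series"
proof -
  from int_q_series_eta_f[OF assms] obtain a where "has_int_q_expansion (eta_f j) a"
    by (rule int_q_seriesE)
  hence "(\<lambda>q. eta_f j (- q)) \<in> int_q_series"
    by (rule int_q_seriesI[OF has_int_q_expansion_reflect])
  from int_q_series_mult[OF this int_q_series_inverse_eta_f[OF assms]] show ?thesis
    by (rule int_q_series_cong) (simp add: eta_u_def divide_inverse)
qed

text \<open>The square is f_(2j)^6 / (f_j^4 f_(4j)^2). Splitting the numerator as f_(2j)^2 f_(2j)^4
  gives two quotients, f_(2j)^2 / f_j^4 and f_(2j)^4 / f_(4j)^2, each congruent to 1 by
  \<open>qcong_eta_f_fourth\<close>.\<close>

lemma qcong_eta_u_square:
  assumes "odd j"
  shows "qcong 4 (\<lambda>q. eta_u j q ^ 2) (\<lambda>_. 1)"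
proof -
  have j: "j \<ge> 1" using assms by (simp add: Suc_le_eq odd_pos)
  let ?I = "\<lambda>k q. inverse (eta_f k q)"
  have unit: "qcong 4 (\<lambda>q. ?I k q ^ 4 * eta_f (2 * k) q ^ 2) (\<lambda>_. 1)" if "k \<ge> 1" for k
  proof -
    have "qcong 4 (\<lambda>q. ?I k q ^ 4 * eta_f k q ^ 4) (\<lambda>q. ?I k q ^ 4 * eta_f (2 * k) q ^ 2)"
      by (intro qcong_mult_left qcong_eta_f_fourth int_q_series_power int_q_series_inverse_eta_f that)
    hence "qcong 4 (\<lambda>_. 1) (\<lambda>q. ?I k q ^ 4 * eta_f (2 * k) q ^ 2)"
      by (rule qcong_cong) (use that in \<open>simp_all add: eta_f_nonzero flip: power_mult_distrib\<close>)
    thus ?thesis by (rule qcong_sym)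
  qed
  have "qcong 4 (\<lambda>q. ?I (4 * j) q ^ 2 * eta_f (2 * j) q ^ 4) (\<lambda>q. ?I (4 * j) q ^ 2 * eta_f (4 * j) q ^ 2)"
    using qcong_mult_left[OF qcong_eta_f_fourth[of "2 * j"], of "\<lambda>q. ?I (4 * j) q ^ 2"] j
    by (simp add: int_q_series_power int_q_series_inverse_eta_f)
  hence "qcong 4 (\<lambda>q. ?I (4 * j) q ^ 2 * eta_f (2 * j) q ^ 4) (\<lambda>_. 1)"
    by (rule qcong_cong) (use j in \<open>simp_all add: eta_f_nonzero flip: power_mult_distrib\<close>)
  from qcong_one_mult[OF unit[OF j] this]
  have "qcong 4 (\<lambda>q. (?I j q ^ 4 * eta_f (2 * j) q ^ 2) * (?I (4 * j) q ^ 2 * eta_f (2 * j) q ^ 4)) (\<lambda>_. 1)"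
    using j by (simp add: int_q_series_mult int_q_series_power int_q_series_inverse_eta_f int_q_series_eta_f)
  moreover have "(x ^ 4 * y ^ 2) * (z ^ 2 * y ^ 4) = (y ^ 3 * x ^ 2 * z) ^ 2" for x y z :: complex
    by algebra
  ultimately show ?thesis
    by (elim qcong_cong) (simp_all only: eta_u_odd[OF _ assms])
qed

text \<open>With K = f_2 / (f_1^2 f_4) the left side is K f_2^2. Replacing f_2^2 by f_1^4 modulo 4
  turns it into the right side.\<close>

lemma qcong_eta_u_1: "qcong 4 (eta_u 1) (\<lambda>q. eta_f 1 q ^ 2 * eta_f 2 q / eta_f 4 q)"
proof -
  let ?K = "\<lambda>q. inverse (eta_f 1 q) ^ 2 * eta_f 2 q * inverse (eta_f 4 q)"
  have "qcong 4 (\<lambda>q. ?K q * eta_f 1 q ^ 4) (\<lambda>q. ?K q * eta_f 2 q ^ 2)"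
    using qcong_eta_f_fourth[of 1]
    by (intro qcong_mult_left int_q_series_mult int_q_series_power int_q_series_inverse_eta_f
        int_q_series_eta_f) simp_all
  from qcong_sym[OF this] show ?thesis
  proof (rule qcong_cong)
    fix q :: complex assume q: "norm q < 1"
    show "?K q * eta_f 2 q ^ 2 = eta_u 1 q"
      using eta_u_odd[OF q, of 1] by (simp add: power2_eq_square power3_eq_cube mult_ac)
    show "?K q * eta_f 1 q ^ 4 = eta_f 1 q ^ 2 * eta_f 2 q / eta_f 4 q"
      using eta_f_nonzero[OF q, of 1] by (simp add: field_simps power2_eq_square power4_eq_xxxx)
  qed
qed

lemma eta_quotient_reflect:
  assumes "norm q < 1"
  shows "eta_quotient e (- q) = eta_quotient e q * (\<Prod>j\<in>eta_support e. eta_u j q powi e j)"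
  unfolding eta_quotient_def prod.distrib[symmetric]
proof (rule prod.cong)
  fix j assume "j \<in> eta_support e"
  hence "eta_f j q \<noteq> 0" using assms by (intro eta_f_nonzero) (auto simp: eta_support_def)
  thus "eta_f j (- q) powi e j = eta_f j q powi e j * eta_u j q powi e j"
    by (simp add: eta_u_def flip: power_int_mult_distrib)
qed simp

lemma int_q_series_power_int:
  assumes "F \<in> int_q_series" "F 0 = 1" "\<And>q. norm q < 1 \<Longrightarrow> F q \<noteq> 0"
  shows "(\<lambda>q. F q powi k) \<in> int_q_series"
  unfolding power_int_def
  by (cases "k \<ge> 0") (simp_all add: int_q_series_power int_q_series_inverse assms)

theorem theorem2p3:
  fixes e :: "nat \<Rightarrow> int" and a b :: "nat \<Rightarrow> int"
  assumes "finite (eta_support e)"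
    and "odd (e 1)"
    and "\<And>j. j > 1 \<Longrightarrow> odd j \<Longrightarrow> even (e j)"
    and "has_int_q_expansion (eta_quotient e) a"
    and "has_int_q_expansion
           (\<lambda>q. eta_quotient e q * ((eta_f 1 q)\<^sup>2 * eta_f 2 q / eta_f 4 q)) b"
  shows "\<forall>n. [a (2 * n) - b (2 * n) = 0] (mod 4) \<and>
             [a (2 * n + 1) + b (2 * n + 1) = 0] (mod 4)"
proof -
  let ?S = "eta_support e" and ?w = "\<lambda>q. (eta_f 1 q)\<^sup>2 * eta_f 2 q / eta_f 4 q"
  have series: "(\<lambda>q. eta_u j q powi k) \<in> int_q_series" if "j \<ge> 1" for j k
    by (intro int_q_series_power_int int_q_series_eta_u eta_u_0 eta_u_nonzero that)
  have even_exp: "qcong 4 (\<lambda>q. eta_u j q powi k) (\<lambda>_. 1)" if "odd j" "even k" for j k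
    using that odd_pos[of j]
    by (intro qcong_power_int_even int_q_series_eta_u eta_u_0 eta_u_nonzero qcong_eta_u_square) auto
  \<comment> \<open>For even \<open>j\<close> the factor is exactly 1 on the disk; for odd j > 1 the
    exponent is even.\<close>
  have other: "qcong 4 (\<lambda>q. eta_u j q powi e j) (\<lambda>_. 1)" if "j \<in> ?S - {1}" for j
  proof (cases "even j")
    case True
    thus ?thesis using that
      by (intro qcong_cong[OF qcong_refl[of 4 "\<lambda>_. 1"]]) (auto simp: eta_u_even eta_support_def)
  next
    case False
    thus ?thesis using that assms(3)[of j] by (intro even_exp) (auto simp: eta_support_def)
  qed
  have rest: "qcong 4 (\<lambda>q. \<Prod>j\<in>?S - {1}. eta_u j q powi e j) (\<lambda>_. 1)"
    by (intro qcong_one_prod other series) (auto simp: eta_support_def)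
  \<comment> \<open>As \<open>e 1\<close> is odd, \<open>e 1 - 1\<close> is even and its power is
    congruent to 1, which leaves a single factor \<open>eta_u 1\<close>.\<close>
  have "qcong 4 (\<lambda>q. eta_u 1 q powi (e 1 - 1) * eta_u 1 q) ?w"
    using assms(2)
    by (intro qcong_one_mult even_exp qcong_eta_u_1 int_q_series_eta_u) auto
  moreover have "eta_u 1 q powi (e 1 - 1) * eta_u 1 q = eta_u 1 q powi e 1" if "norm q < 1" for q
    using eta_u_nonzero[OF that, of 1] by (simp add: power_int_diff)
  ultimately have one: "qcong 4 (\<lambda>q. eta_u 1 q powi e 1) ?w"
    by (rule qcong_cong) auto
  have "1 \<in> ?S" using assms(2) by (auto simp: eta_support_def)
  hence "(\<Prod>j\<in>?S. eta_u j q powi e j) = (\<Prod>j\<in>?S - {1}. eta_u j q powi e j) * eta_u 1 q powi e 1" for q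
    using assms(1) by (simp add: prod.remove mult.commute)
  with qcong_one_mult[OF rest one series]
  have "qcong 4 (\<lambda>q. \<Prod>j\<in>?S. eta_u j q powi e j) ?w" by simp
  from qcong_mult_left[OF this int_q_seriesI[OF assms(4)]]
  have "qcong 4 (\<lambda>q. eta_quotient e (- q)) (\<lambda>q. eta_quotient e q * ?w q)"
    by (rule qcong_cong) (simp_all add: eta_quotient_reflect)
  \<comment> \<open>Coefficients of A(-q) against those of B(q); the sign is what separates the even
    and odd cases of the claim.\<close>
  hence cong: "[(-1) ^ n * a n = b n] (mod 4)" for n
    by (rule qcong_imp_cong[OF _ has_int_q_expansion_reflect[OF assms(4)] assms(5)])
  show ?thesis
  proof (intro allI conjI)
    fix n
    show "[a (2 * n) - b (2 * n) = 0] (mod 4)"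
      using cong[of "2 * n"] by (simp add: cong_iff_dvd_diff)
    \<comment> \<open>At an odd index the congruence reads -a = b modulo 4, so the difference is the
      negative of the required sum.\<close>
    have "4 dvd - (a (2 * n + 1) + b (2 * n + 1))"
      using cong[of "2 * n + 1"] by (simp add: cong_iff_dvd_diff)
    thus "[a (2 * n + 1) + b (2 * n + 1) = 0] (mod 4)"
      by (simp only: cong_iff_dvd_diff dvd_minus_iff diff_zero)
  qed
qed

end
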